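(* Let $T>0$, let $p\ge 1$, and for $t\in[0,T]$ let $A_t$ and $B_t$ be the pointwise curvature and gradient-noise operators (symmetric positive semidefinite $p\times p$ real matrices) defined in the context. For $\mu\in\mathcal{P}([0,T])$ (the Borel probability measures on $[0,T]$) put $H[\mu]=\int_0^T A_t\,d\mu(t)$, $\Gamma[\mu]=\int_0^T B_t\,d\mu(t)$, and $$\mathcal{J}(\mu)=\mathrm{Tr}\bigl(\bar A\,H[\mu]^{-1}\,\Gamma[\mu]\,H[\mu]^{-1}\bigr),\qquad \bar A=\int_0^T \dot{\mathrm{SNR}}(\tau)\,A_\tau\,d\tau .$$ Assume that $t\mapsto A_t$ and $t\mapsto B_t$ are continuous on $[0,T]$ and that $A_t\succ 0$ (positive definite) for every $t\in[0,T]$. Then the minimization problem $\min_{\mu\in\mathcal{P}([0,T])}\mathcal{J}(\mu)$ admits an atomic minimizer: there exist $r\le p(p+1)+1$, points $t_1,\dots,t_r\in[0,T]$ and weights $w_1,\dots,w_r\ge 0$ with $\sum_{i=1}^r w_i=1$ such that $\mu^*_{\mathrm{at}}=\sum_{i=1}^r w_i\,\delta_{t_i}$ satisfies $$\mathcal{J}(\mu^*_{\mathrm{at}})=\min_{\mu\in\mathcal{P}([0,T])}\mathcal{J}(\mu).$$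
   Context: Setting. $x_0$ is a random vector in $\mathbb{R}^d$ (the data), and for $t\in[0,T]$ the noisy vector is $x_t=x_0+\sigma(t)z$ with $z\sim\mathcal{N}(0,I_d)$ independent of $x_0$. A denoiser $s_\theta(x,t)\in\mathbb{R}^d$ has a parameter $\theta\in\mathbb{R}^p$, and there is a unique fixed parameter $\theta^\star$ (not depending on $\mu$) with $s_{\theta^\star}(x_t,t)=\mathbb{E}[x_0\mid x_t]$ for all $t\in[0,T]$. Define the Jacobian $J_t(x):=\partial_\theta s_\theta(x,t)|_{\theta=\theta^\star}\in\mathbb{R}^{d\times p}$ and the residual covariance $\Sigma_t(x):=\mathrm{Var}(x_0-\mathbb{E}[x_0\mid x_t]\mid x_t=x)\in\mathbb{R}^{d\times d}$. The pointwise curvature and noise operators are $$A_t:=\mathbb{E}_{x_t}\bigl[J_t(x_t)^\top J_t(x_t)\bigr],\qquad B_t:=\mathbb{E}_{x_t}\bigl[J_t(x_t)^\top\Sigma_t(x_t)J_t(x_t)\bigr],$$ with all second moments assumed finite. The function $\dot{\mathrm{SNR}}:[0,T]\to[0,\infty)$ is a fixed measurable weight function (the signed rate of the signal-to-noise ratio, equal to $\dot\sigma(t)/\sigma^3(t)$ for the channel above), for which the integral defining $\bar A$ is assumed to converge, so that $\bar A$ is a fixed real symmetric $p\times p$ matrix. *)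

theory Defs
  imports "HOL-Probability.Probability"
begin

section \<open>Noisy observations and conditional moments of random vectors\<close>

definition noisy :: "('a \<Rightarrow> real^'d) \<Rightarrow> ('a \<Rightarrow> real^'d) \<Rightarrow> (real \<Rightarrow> real) \<Rightarrow> real \<Rightarrow> 'a \<Rightarrow> real^'d" where
  "noisy x0 z \<sigma> t = (\<lambda>\<omega>. x0 \<omega> + \<sigma> t *\<^sub>R z \<omega>)"

definition std_gaussian_density :: "real^'d \<Rightarrow> real" where
  "std_gaussian_density v = (\<Prod>i\<in>UNIV. std_normal_density (v $ i))"

text \<open>The sigma-algebra generated by a random vector, as a measure space on the sample space.\<close>

definition sigma_gen :: "'a measure \<Rightarrow> ('a \<Rightarrow> real^'d) \<Rightarrow> 'a measure" where
  "sigma_gen M X = vimage_algebra (space M) X borel"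

definition cond_mean :: "'a measure \<Rightarrow> 'a measure \<Rightarrow> ('a \<Rightarrow> real^'d) \<Rightarrow> 'a \<Rightarrow> real^'d" where
  "cond_mean M F Y = (\<lambda>\<omega>. \<chi> i. real_cond_exp M F (\<lambda>\<omega>'. Y \<omega>' $ i) \<omega>)"

definition cond_cov :: "'a measure \<Rightarrow> 'a measure \<Rightarrow> ('a \<Rightarrow> real^'d) \<Rightarrow> 'a \<Rightarrow> real^'d^'d" where
  "cond_cov M F Y =
     (\<lambda>\<omega>. \<chi> i j. real_cond_exp M F
        (\<lambda>\<omega>'. (Y \<omega>' - cond_mean M F Y \<omega>') $ i * (Y \<omega>' - cond_mean M F Y \<omega>') $ j) \<omega>)"

text \<open>The function \<open>S\<close> is a version of \<open>x \<mapsto> Var (x0 - E[x0 | X] | X = x)\<close>. Such a function is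
  determined only up to null sets of the law of \<open>X\<close>, hence a predicate and not a function.\<close>

definition is_residual_cov ::
  "'a measure \<Rightarrow> ('a \<Rightarrow> real^'d) \<Rightarrow> ('a \<Rightarrow> real^'d) \<Rightarrow> (real^'d \<Rightarrow> real^'d^'d) \<Rightarrow> bool" where
  "is_residual_cov M x0 X S \<longleftrightarrow>
     S \<in> borel_measurable borel \<and>
     (AE \<omega> in M. S (X \<omega>) =
        cond_cov M (sigma_gen M X) (\<lambda>\<omega>'. x0 \<omega>' - cond_mean M (sigma_gen M X) x0 \<omega>') \<omega>)"

text \<open>The denoiser with parameter \<open>\<theta>\<close> is the posterior mean at every noise level (almost surely,
  since conditional expectations are defined only up to null sets).\<close>

definition is_posterior_mean_param ::
  "'a measure \<Rightarrow> ('a \<Rightarrow> real^'d) \<Rightarrow> (real \<Rightarrow> 'a \<Rightarrow> real^'d) \<Rightarrow> real \<Rightarrow>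
   (real^'p \<Rightarrow> real^'d \<Rightarrow> real \<Rightarrow> real^'d) \<Rightarrow> real^'p \<Rightarrow> bool" where
  "is_posterior_mean_param M x0 x T s \<theta> \<longleftrightarrow>
     (\<forall>t\<in>{0..T}. AE \<omega> in M. s \<theta> (x t \<omega>) t = cond_mean M (sigma_gen M (x t)) x0 \<omega>)"

section \<open>Curvature and noise operators\<close>

text \<open>The integrands are kept separate from their expectations so that finiteness of the second
  moments can be stated: the Bochner integral of a non-integrable function is 0.\<close>

definition curv_integrand ::
  "('a \<Rightarrow> real^'d) \<Rightarrow> (real^'d \<Rightarrow> real^'p^'d) \<Rightarrow> 'a \<Rightarrow> real^'p^'p" where
  "curv_integrand X J = (\<lambda>\<omega>. transpose (J (X \<omega>)) ** J (X \<omega>))"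

definition noise_integrand ::
  "('a \<Rightarrow> real^'d) \<Rightarrow> (real^'d \<Rightarrow> real^'p^'d) \<Rightarrow> (real^'d \<Rightarrow> real^'d^'d) \<Rightarrow> 'a \<Rightarrow> real^'p^'p" where
  "noise_integrand X J S = (\<lambda>\<omega>. transpose (J (X \<omega>)) ** S (X \<omega>) ** J (X \<omega>))"

definition curv_op ::
  "'a measure \<Rightarrow> ('a \<Rightarrow> real^'d) \<Rightarrow> (real^'d \<Rightarrow> real^'p^'d) \<Rightarrow> real^'p^'p" where
  "curv_op M X J = (LINT \<omega>|M. curv_integrand X J \<omega>)"

definition noise_op ::
  "'a measure \<Rightarrow> ('a \<Rightarrow> real^'d) \<Rightarrow> (real^'d \<Rightarrow> real^'p^'d) \<Rightarrow> (real^'d \<Rightarrow> real^'d^'d) \<Rightarrow> real^'p^'p" where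
  "noise_op M X J S = (LINT \<omega>|M. noise_integrand X J S \<omega>)"

definition pos_definite :: "real^'n^'n \<Rightarrow> bool" where
  "pos_definite P \<longleftrightarrow> transpose P = P \<and> (\<forall>v. v \<noteq> 0 \<longrightarrow> v \<bullet> (P *v v) > 0)"

section \<open>The objective on time distributions\<close>

abbreviation time_space :: "real \<Rightarrow> real measure" where
  "time_space T \<equiv> restrict_space borel {0..T}"

text \<open>The objective \<open>Tr (Abar H^-1 G H^-1)\<close>, where \<open>H\<close> and \<open>G\<close> are the \<open>\<mu>\<close>-averages of \<open>A\<close>
  and \<open>B\<close>.\<close>

definition mean_op :: "(real \<Rightarrow> real^'p^'p) \<Rightarrow> real measure \<Rightarrow> real^'p^'p" where
  "mean_op A \<mu> = (LINT t|\<mu>. A t)"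

definition objective ::
  "real^'p^'p \<Rightarrow> (real \<Rightarrow> real^'p^'p) \<Rightarrow> (real \<Rightarrow> real^'p^'p) \<Rightarrow> real measure \<Rightarrow> real" where
  "objective Abar A B \<mu> =
     trace (Abar ** matrix_inv (mean_op A \<mu>) ** mean_op B \<mu> ** matrix_inv (mean_op A \<mu>))"

text \<open>The mixture \<open>\<Sum>i\<in>I. w i * \<delta>_(t i)\<close> of Dirac measures on the measurable space \<open>N\<close>.\<close>

definition dirac_mixture :: "'b measure \<Rightarrow> 'i set \<Rightarrow> ('i \<Rightarrow> real) \<Rightarrow> ('i \<Rightarrow> 'b) \<Rightarrow> 'b measure" where
  "dirac_mixture N I w t =
     measure_of (space N) (sets N) (\<lambda>S. \<Sum>i\<in>I. ennreal (w i) * emeasure (return N (t i)) S)"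

end

theory Submission
  imports Defs
begin

text \<open>The objective depends on \<open>\<mu>\<close> only through the pair \<open>(H[\<mu>], \<Gamma>[\<mu>])\<close>, the mean of the curve
  \<open>t \<mapsto> (A t, B t)\<close>, and such a mean lies in the convex hull of the curve. This hull is compact and
  its first components are positive definite, so the objective attains its minimum over it. As the
  residual covariance is symmetric, the curve lies in the space of pairs of symmetric matrices, which has dimension \<open>p (p + 1)\<close>, and
  Caratheodory's theorem writes the minimizing point as the mean of at most \<open>p (p + 1) + 1\<close> atoms.\<close>

section \<open>Continuity of matrix inversion\<close>

lemma matrix_mul_matrix_inv:
  fixes A :: "real^'n^'n"
  assumes "invertible A"
  shows "A ** matrix_inv A = mat 1"
  using assms unfolding invertible_def matrix_inv_def by (rule someI2_ex) simp

text \<open>Column \<open>j\<close> of the inverse solves \<open>A *v x = axis j 1\<close>, so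
  Cramer's rule applies. Entries of the inverse thus become quotients of determinants, which makes
  their continuity in \<open>A\<close> visible.\<close>

lemma matrix_inv_cramer:
  fixes A :: "real^'n^'n"
  assumes "invertible A"
  shows "matrix_inv A $ k $ j = det (\<chi> i l. if l = k then axis j 1 $ i else A $ i $ l) / det A"
proof -
  have "A *v (matrix_inv A *v axis j 1) = axis j 1"
    by (simp add: matrix_vector_mul_assoc matrix_mul_matrix_inv[OF assms])
  then have "matrix_inv A *v axis j 1 =
      (\<chi> k. det (\<chi> i l. if l = k then axis j 1 $ i else A $ i $ l) / det A)"
    using assms by (subst (asm) cramer) (auto simp: invertible_det_nz)
  moreover have "matrix_inv A $ k $ j = (matrix_inv A *v axis j 1) $ k"
    by (simp add: matrix_vector_mul_component inner_axis)
  ultimately show ?thesis by simp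
qed

lemma continuous_on_det:
  fixes f :: "'a::topological_space \<Rightarrow> real^'n^'n"
  assumes "\<And>i j. continuous_on S (\<lambda>x. f x $ i $ j)"
  shows "continuous_on S (\<lambda>x. det (f x))"
  unfolding det_def by (intro continuous_intros assms)

lemma continuous_on_matrix_inv:
  fixes f :: "'a::topological_space \<Rightarrow> real^'n^'n"
  assumes f: "continuous_on S f" and inv: "\<And>x. x \<in> S \<Longrightarrow> invertible (f x)"
  shows "continuous_on S (\<lambda>x. matrix_inv (f x))"
proof -
  have entry: "continuous_on S (\<lambda>x. f x $ i $ j)" for i j
    by (intro continuous_intros f)
  have num: "continuous_on S (\<lambda>x. det (\<chi> i l. if l = k then axis j 1 $ i else f x $ i $ l))" for k j
  proof (rule continuous_on_det)
    show "continuous_on S (\<lambda>x. (\<chi> i l. if l = k then axis j 1 $ i else f x $ i $ l) $ i $ l)" for i l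
      by (cases "l = k") (simp_all add: entry)
  qed
  have "continuous_on S (\<lambda>x. \<chi> k j. det (\<chi> i l. if l = k then axis j 1 $ i else f x $ i $ l) / det (f x))"
    using inv by (intro continuous_on_vec_lambda continuous_on_divide num continuous_on_det entry)
      (auto simp: invertible_det_nz)
  then show ?thesis
    by (rule continuous_on_eq) (simp add: vec_eq_iff matrix_inv_cramer inv)
qed

lemma continuous_on_matrix_mult:
  fixes f :: "'a::topological_space \<Rightarrow> real^'n^'m" and g :: "'a \<Rightarrow> real^'k^'n"
  assumes "continuous_on S f" "continuous_on S g"
  shows "continuous_on S (\<lambda>x. f x ** g x)"
  unfolding matrix_matrix_mult_def by (intro continuous_intros continuous_on_vec_lambda assms)

section \<open>Positive definite and symmetric matrices\<close>

text \<open>A nonzero \<open>v\<close> in the kernel would give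
  \<open>v \<bullet> (P *v v) = 0\<close>, so the kernel is trivial.\<close>

lemma pos_definite_invertible:
  assumes "pos_definite P"
  shows "invertible P"
proof -
  have "v = 0" if "P *v v = 0" for v
    using assms that unfolding pos_definite_def by fastforce
  then show ?thesis
    unfolding invertible_left_inverse matrix_left_invertible_ker by blast
qed

lemma linear_transpose: "linear (transpose :: real^'n^'m \<Rightarrow> real^'m^'n)"
  by (rule linearI) (simp_all add: transpose_def vec_eq_iff)

lemma convex_pos_definite: "convex {P :: real^'n^'n. pos_definite P}"
proof (rule convexI)
  fix P Q :: "real^'n^'n" and u v :: real
  assume *: "P \<in> {P. pos_definite P}" "Q \<in> {P. pos_definite P}" "0 \<le> u" "0 \<le> v" "u + v = 1"
  have "x \<bullet> ((u *\<^sub>R P + v *\<^sub>R Q) *v x) > 0" if "x \<noteq> 0" for x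
  proof -
    have "x \<bullet> ((u *\<^sub>R P + v *\<^sub>R Q) *v x) = u * (x \<bullet> (P *v x)) + v * (x \<bullet> (Q *v x))"
      by (simp add: matrix_vector_mult_add_rdistrib scaleR_matrix_vector_assoc[symmetric] inner_add_right)
    moreover have "x \<bullet> (P *v x) > 0" "x \<bullet> (Q *v x) > 0"
      using * that by (auto simp: pos_definite_def)
    \<comment> \<open>One of the two weights may vanish, but not both; this keeps the inequality
      strict.\<close>
    moreover have "u > 0 \<or> v > 0" using * by linarith
    ultimately show ?thesis
      using * by (auto intro: add_pos_nonneg add_nonneg_pos)
  qed
  then show "u *\<^sub>R P + v *\<^sub>R Q \<in> {P. pos_definite P}"
    using * by (simp add: pos_definite_def linear_add[OF linear_transpose] linear_scale[OF linear_transpose])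
qed

lemma subspace_symmetric_pairs:
  "subspace {(P :: real^'n^'n, Q :: real^'n^'n). transpose P = P \<and> transpose Q = Q}"
  unfolding subspace_def
  by (auto simp: linear_add[OF linear_transpose] linear_scale[OF linear_transpose]
      linear_0[OF linear_transpose] zero_prod_def)

text \<open>A pair of symmetric matrices is encoded by a single square matrix, holding the upper triangle
  of the first and the strict lower triangle of the second, and by the diagonal of the second.\<close>

lemma dim_symmetric_pairs_le:
  "dim {(P :: real^'n^'n, Q :: real^'n^'n). transpose P = P \<and> transpose Q = Q}
    \<le> CARD('n) * (CARD('n) + 1)"
proof -
  let ?S = "{(P :: real^'n^'n, Q :: real^'n^'n). transpose P = P \<and> transpose Q = Q}"
  \<comment> \<open>The index type carries no order; an injection into the naturals supplies one, so
    that upper and lower triangles make sense.\<close>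
  obtain e :: "'n \<Rightarrow> nat" where e: "inj e"
    using finite_imp_inj_to_nat_seg[of "UNIV :: 'n set"] by auto
  define F :: "(real^'n^'n) \<times> (real^'n^'n) \<Rightarrow> (real^'n^'n) \<times> (real^'n)" where
    "F = (\<lambda>(P, Q). (\<chi> i j. if e i \<le> e j then P $ i $ j else Q $ i $ j, \<chi> i. Q $ i $ i))"
  have F: "linear F"
    by (rule linearI) (auto simp: F_def vec_eq_iff split: prod.splits)
  have "inj_on F ?S"
  proof (rule inj_onI, clarify, intro conjI)
    fix P Q P' Q' :: "real^'n^'n"
    assume sym: "transpose P = P" "transpose Q = Q" "transpose P' = P'" "transpose Q' = Q'"
      and eq: "F (P, Q) = F (P', Q')"
    have swap: "P $ i $ j = P $ j $ i" "Q $ i $ j = Q $ j $ i"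
      "P' $ i $ j = P' $ j $ i" "Q' $ i $ j = Q' $ j $ i" for i j
      using sym[THEN arg_cong, of "\<lambda>M. M $ j $ i"] by (simp_all add: transpose_def)
    have eq': "(if e i \<le> e j then P $ i $ j else Q $ i $ j) = (if e i \<le> e j then P' $ i $ j else Q' $ i $ j)"
      "Q $ i $ i = Q' $ i $ i" for i j
      using eq by (auto simp: F_def vec_eq_iff)
    \<comment> \<open>One of the positions \<open>(i, j)\<close> and \<open>(j, i)\<close> lies in
      the upper triangle, where \<open>F\<close> stores the first matrix; symmetry gives the
      other.\<close>
    have "P $ i $ j = P' $ i $ j" for i j
      using eq'(1)[of i j] eq'(1)[of j i] swap(1)[of i j] swap(3)[of i j] by (cases "e i \<le> e j") auto
    moreover have "Q $ i $ j = Q' $ i $ j" for i j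
    \<comment> \<open>Off the diagonal, injectivity of \<open>e\<close> puts exactly one of
      \<open>(i, j)\<close> and \<open>(j, i)\<close> strictly below it, where \<open>F\<close>
      stores the second matrix. The diagonal is stored separately.\<close>
    proof (cases "i = j")
      case False
      then have "e i \<noteq> e j" using e by (auto dest: injD)
      then show ?thesis
        using eq'(1)[of i j] eq'(1)[of j i] swap(2)[of i j] swap(4)[of i j] by (cases "e i < e j") auto
    qed (use eq' in auto)
    ultimately show "P = P'" "Q = Q'" by (simp_all add: vec_eq_iff)
  qed
  \<comment> \<open>Preservation of dimension asks for injectivity on the span, which is
    \<open>?S\<close> itself because \<open>?S\<close> is a subspace.\<close>
  then have "dim (F ` ?S) = dim ?S"
    using F by (intro dim_image_eq) (simp_all only: span_eq_iff[THEN iffD2, OF subspace_symmetric_pairs])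
  moreover have "dim (F ` ?S) \<le> DIM((real^'n^'n) \<times> (real^'n))"
    by (rule dim_subset_UNIV)
  ultimately show ?thesis by simp
qed

section \<open>Means under probability measures\<close>

text \<open>If the mean were outside \<open>S\<close>, a hyperplane would separate it strictly from
  \<open>S\<close>; integrating \<open>a \<bullet> f x > b\<close> contradicts
  \<open>a \<bullet> integral\<^sup>L M f < b\<close>.\<close>

lemma (in prob_space) integral_in_closed_convex:
  fixes f :: "'a \<Rightarrow> 'b::euclidean_space"
  assumes f: "integrable M f" and S: "convex S" "closed S" and fS: "\<And>x. x \<in> space M \<Longrightarrow> f x \<in> S"
  shows "integral\<^sup>L M f \<in> S"
proof (rule ccontr)
  assume "integral\<^sup>L M f \<notin> S"
  then obtain a b where ab: "a \<bullet> integral\<^sup>L M f < b" "\<forall>x\<in>S. a \<bullet> x > b"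
    using separating_hyperplane_closed_point[OF S] by blast
  have "b = (LINT x|M. b)" by (simp add: prob_space)
  also have "\<dots> \<le> (LINT x|M. a \<bullet> f x)"
    using ab fS f by (intro integral_mono) (auto intro!: less_imp_le)
  also have "\<dots> = a \<bullet> integral\<^sup>L M f" using f by simp
  finally show False using ab by simp
qed

text \<open>A continuous function on a compact set is bounded, and bounded measurable functions are
  integrable for a probability measure.\<close>

lemma integrable_continuous_compact_space:
  fixes f :: "'a::topological_space \<Rightarrow> 'b::euclidean_space"
  assumes "prob_space \<mu>" and sets: "sets \<mu> = sets (restrict_space borel C)"
    and f: "continuous_on C f" and "compact C"
  shows "integrable \<mu> f"
proof -
  interpret prob_space \<mu> by fact
  have space: "space \<mu> = C"
    using sets_eq_imp_space_eq[OF sets] by (simp add: space_restrict_space)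
  obtain K where "\<And>x. x \<in> C \<Longrightarrow> norm (f x) \<le> K"
    using compact_imp_bounded[OF compact_continuous_image[OF f \<open>compact C\<close>]]
    by (auto simp: bounded_iff)
  moreover have "f \<in> borel_measurable \<mu>"
    using borel_measurable_continuous_on_restrict[OF f] measurable_cong_sets[OF sets refl] by blast
  ultimately show ?thesis
    using space by (intro integrable_const_bound[where B = K]) auto
qed

section \<open>Finite mixtures of Dirac measures\<close>

lemma measurable_point_measure:
  "(\<And>i. i \<in> I \<Longrightarrow> t i \<in> space N) \<Longrightarrow> t \<in> measurable (point_measure I w) N"
  by (auto simp: measurable_def sets_point_measure space_point_measure)

text \<open>Viewing the mixture as the image of a weighted counting measure on the index set reduces
  its integrals and its total mass to finite sums. The map \<open>t\<close> need not be injective: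
  atoms at the same point add up.\<close>

lemma dirac_mixture_eq_distr:
  assumes I: "finite I" and t: "\<And>i. i \<in> I \<Longrightarrow> t i \<in> space N"
  shows "dirac_mixture N I w t = distr (point_measure I w) N t"
proof -
  let ?D = "distr (point_measure I w) N t"
  have t': "t \<in> measurable (point_measure I w) N"
    using t by (rule measurable_point_measure)
  have "(\<Sum>i\<in>I. ennreal (w i) * emeasure (return N (t i)) S) = emeasure ?D S" if S: "S \<in> sets N" for S
  proof -
    have "emeasure ?D S = (\<Sum>i\<in>t -` S \<inter> I. ennreal (w i))"
      using t' S I by (simp add: emeasure_distr space_point_measure emeasure_point_measure_finite)
    also have "\<dots> = (\<Sum>i\<in>I. ennreal (w i) * indicator S (t i))"
      using I by (intro sum.mono_neutral_cong_left) (auto simp: indicator_def)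
    finally show ?thesis using S by simp
  qed
  then have "dirac_mixture N I w t = measure_of (space N) (sets N) (emeasure ?D)"
    unfolding dirac_mixture_def
    by (intro measure_of_eq) (auto simp: sets.space_closed sets.sigma_sets_eq)
  also have "\<dots> = ?D"
    using measure_of_of_measure[of ?D] by simp
  finally show ?thesis .
qed

lemma integral_dirac_mixture:
  fixes f :: "'b \<Rightarrow> 'c::{banach, second_countable_topology}"
  assumes I: "finite I" and t: "\<And>i. i \<in> I \<Longrightarrow> t i \<in> space N" and w: "\<And>i. i \<in> I \<Longrightarrow> 0 \<le> w i"
    and f: "f \<in> borel_measurable N"
  shows "integral\<^sup>L (dirac_mixture N I w t) f = (\<Sum>i\<in>I. w i *\<^sub>R f (t i))"
proof -
  have "t \<in> measurable (point_measure I w) N"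
    using t by (rule measurable_point_measure)
  then show ?thesis
    using assms by (simp add: dirac_mixture_eq_distr integral_distr lebesgue_integral_point_measure_finite)
qed

lemma dirac_mixture_in_prob_algebra:
  assumes I: "finite I" and t: "\<And>i. i \<in> I \<Longrightarrow> t i \<in> space N" and w: "\<And>i. i \<in> I \<Longrightarrow> 0 \<le> w i"
    and w1: "sum w I = 1"
  shows "dirac_mixture N I w t \<in> space (prob_algebra N)"
proof -
  have "t \<in> measurable (point_measure I w) N"
    using t by (rule measurable_point_measure)
  moreover have "prob_space (point_measure I w)"
    using I w w1 by (intro prob_spaceI) (simp add: space_point_measure emeasure_point_measure_finite)
  ultimately have "prob_space (distr (point_measure I w) N t)"
    by (simp add: prob_space.prob_space_distr)
  then show ?thesis
    using I t by (simp add: space_prob_algebra dirac_mixture_eq_distr)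
qed

section \<open>Atomic minimizers of functions of a mean\<close>

text \<open>Stating the bound through the affine dimension of the curve, not the dimension of the
  ambient space, lets the symmetry of the matrices enter later.\<close>

lemma atomic_minimizer:
  fixes f :: "'a::t2_space \<Rightarrow> 'b::euclidean_space" and \<phi> :: "'b \<Rightarrow> real"
  assumes C: "compact C" "C \<noteq> {}" and f: "continuous_on C f"
    and \<phi>: "continuous_on (convex hull (f ` C)) \<phi>"
  obtains r :: nat and ts :: "nat \<Rightarrow> 'a" and w :: "nat \<Rightarrow> real"
  where "int r \<le> aff_dim (f ` C) + 1" "\<And>i. i \<in> {1..r} \<Longrightarrow> ts i \<in> C" "\<And>i. i \<in> {1..r} \<Longrightarrow> 0 \<le> w i"
    "sum w {1..r} = 1"
    "is_arg_min (\<lambda>\<mu>. \<phi> (integral\<^sup>L \<mu> f)) (\<lambda>\<mu>. \<mu> \<in> space (prob_algebra (restrict_space borel C)))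
      (dirac_mixture (restrict_space borel C) {1..r} w ts)"
proof -
  let ?K = "convex hull (f ` C)" and ?N = "restrict_space borel C"
  have K: "compact ?K"
    by (intro compact_convex_hull compact_continuous_image f C)
  have mean: "integral\<^sup>L \<mu> f \<in> ?K" if "\<mu> \<in> space (prob_algebra ?N)" for \<mu>
  proof -
    have \<mu>: "prob_space \<mu>" and sets: "sets \<mu> = sets ?N"
      using that by (auto simp: space_prob_algebra)
    have "space \<mu> = C"
      using sets_eq_imp_space_eq[OF sets] by (simp add: space_restrict_space)
    then show ?thesis
      using K by (intro prob_space.integral_in_closed_convex[OF \<mu>]
          integrable_continuous_compact_space[OF \<mu> sets f C(1)])
        (auto intro: compact_imp_closed hull_inc)
  qed
  obtain y where y: "y \<in> ?K" "\<And>z. z \<in> ?K \<Longrightarrow> \<phi> y \<le> \<phi> z"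
    using continuous_attains_inf[OF K _ \<phi>] C by auto
  \<comment> \<open>Caratheodory's theorem in its affine form: the summand 1 is the gap between the
    dimension and the number of affinely independent points.\<close>
  then obtain S where S: "finite S" "S \<subseteq> f ` C" "int (card S) \<le> aff_dim (f ` C) + 1" "y \<in> convex hull S"
    by (subst (asm) caratheodory_aff_dim) auto
  then obtain u where u: "\<And>v. v \<in> S \<Longrightarrow> 0 \<le> u v" "sum u S = 1" "(\<Sum>v\<in>S. u v *\<^sub>R v) = y"
    by (auto simp: convex_hull_finite)
  obtain g where g: "bij_betw g {1..card S} S"
    using ex_bij_betw_nat_finite_1[OF S(1)] by blast
  \<comment> \<open>Each point of \<open>S\<close> lies on the curve; \<open>ts\<close> chooses a
    parameter for it, and \<open>w\<close> carries its convex coefficient over to the index.\<close>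
  define ts where "ts = (\<lambda>i. SOME t. t \<in> C \<and> f t = g i)"
  define w where "w = (\<lambda>i. u (g i))"
  have gS: "g i \<in> S" if "i \<in> {1..card S}" for i
    using g that by (auto simp: bij_betw_def)
  have ts: "ts i \<in> C \<and> f (ts i) = g i" if "i \<in> {1..card S}" for i
    unfolding ts_def by (rule someI_ex) (use gS[OF that] S(2) in \<open>force simp: image_iff\<close>)
  have w: "0 \<le> w i" if "i \<in> {1..card S}" for i
    using u(1) gS[OF that] by (simp add: w_def)
  have w1: "sum w {1..card S} = 1"
    unfolding w_def using sum.reindex_bij_betw[OF g, of u] u by simp
  have "integral\<^sup>L (dirac_mixture ?N {1..card S} w ts) f = (\<Sum>i\<in>{1..card S}. w i *\<^sub>R f (ts i))"
    using ts w borel_measurable_continuous_on_restrict[OF f]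
    by (intro integral_dirac_mixture) (auto simp: space_restrict_space)
  also have "\<dots> = (\<Sum>i\<in>{1..card S}. u (g i) *\<^sub>R g i)"
    using ts by (intro sum.cong) (auto simp: w_def)
  also have "\<dots> = y"
    using sum.reindex_bij_betw[OF g, of "\<lambda>v. u v *\<^sub>R v"] u by simp
  finally have "integral\<^sup>L (dirac_mixture ?N {1..card S} w ts) f = y" .
  moreover have "dirac_mixture ?N {1..card S} w ts \<in> space (prob_algebra ?N)"
    using ts w w1 by (intro dirac_mixture_in_prob_algebra) (auto simp: space_restrict_space)
  ultimately have "is_arg_min (\<lambda>\<mu>. \<phi> (integral\<^sup>L \<mu> f)) (\<lambda>\<mu>. \<mu> \<in> space (prob_algebra ?N))
      (dirac_mixture ?N {1..card S} w ts)"
    using y mean by (auto simp: is_arg_min_def not_less)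
  then show thesis
    using that[of "card S" ts w] S ts w w1 by auto
qed

section \<open>Symmetry of the noise operator and the main result\<close>

text \<open>Transposition is bounded linear and so commutes with the integral. The chosen version of
  the residual covariance is known to be symmetric along \<open>X\<close> only almost surely, which
  suffices under the integral.\<close>

lemma noise_op_symmetric:
  fixes J :: "real^'d \<Rightarrow> real^'p^'d"
  assumes S: "is_residual_cov M x0 X S" and int: "integrable M (noise_integrand X J S)"
  shows "transpose (noise_op M X J S) = noise_op M X J S"
proof -
  have "transpose (cond_cov M F Y \<omega>) = cond_cov M F Y \<omega>" for F and Y :: "'a \<Rightarrow> real^'d" and \<omega>
    by (simp add: cond_cov_def transpose_def vec_eq_iff mult.commute)
  then have "AE \<omega> in M. transpose (S (X \<omega>)) = S (X \<omega>)"
    using S unfolding is_residual_cov_def by (auto elim: eventually_mono)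
  then have ae: "AE \<omega> in M. transpose (noise_integrand X J S \<omega>) = noise_integrand X J S \<omega>"
    by (rule AE_mp) (auto simp: noise_integrand_def matrix_transpose_mul matrix_mul_assoc)
  have "transpose (noise_op M X J S) = (LINT \<omega>|M. transpose (noise_integrand X J S \<omega>))"
    unfolding noise_op_def
    by (rule integral_bounded_linear[OF linear_conv_bounded_linear[THEN iffD1, OF linear_transpose] int, symmetric])
  also have "\<dots> = noise_op M X J S"
    unfolding noise_op_def
    using ae int integrable_bounded_linear[OF linear_conv_bounded_linear[THEN iffD1, OF linear_transpose] int]
    by (intro integral_cong_AE) auto
  finally show ?thesis .
qed

theorem proposition6p2:
  fixes M :: "'a measure"
    and x0 z :: "'a \<Rightarrow> real^'d"
    and \<sigma> :: "real \<Rightarrow> real"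
    and T :: real
    and s :: "real^'p \<Rightarrow> real^'d \<Rightarrow> real \<Rightarrow> real^'d"
    and \<theta>star :: "real^'p"
    and x :: "real \<Rightarrow> 'a \<Rightarrow> real^'d"
    and J :: "real \<Rightarrow> real^'d \<Rightarrow> real^'p^'d"
    and \<Sigma>cov :: "real \<Rightarrow> real^'d \<Rightarrow> real^'d^'d"
    and A B :: "real \<Rightarrow> real^'p^'p"
    and snr_rate :: "real \<Rightarrow> real"
    and Abar :: "real^'p^'p"
  assumes "prob_space M" and "T > 0"
    and "x0 \<in> borel_measurable M"
    and "integrable M (\<lambda>\<omega>. (norm (x0 \<omega>))\<^sup>2)"
    and "distributed M lborel z (\<lambda>v. ennreal (std_gaussian_density v))"
    and "prob_space.indep_var M borel x0 borel z"
    and x: "\<And>t. x t = noisy x0 z \<sigma> t"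
    and "is_posterior_mean_param M x0 x T s \<theta>star"
    and "\<And>\<theta>. is_posterior_mean_param M x0 x T s \<theta> \<Longrightarrow> \<theta> = \<theta>star"
    and "\<And>v t. t \<in> {0..T} \<Longrightarrow> (\<lambda>\<theta>. s \<theta> v t) differentiable (at \<theta>star)"
    and J: "\<And>t v. J t v = jacobian (\<lambda>\<theta>. s \<theta> v t) (at \<theta>star)"
    and "\<And>t. t \<in> {0..T} \<Longrightarrow> is_residual_cov M x0 (x t) (\<Sigma>cov t)"
    and "\<And>t. t \<in> {0..T} \<Longrightarrow> integrable M (curv_integrand (x t) (J t))"
    and "\<And>t. t \<in> {0..T} \<Longrightarrow> integrable M (noise_integrand (x t) (J t) (\<Sigma>cov t))"
    and A: "\<And>t. A t = curv_op M (x t) (J t)"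
    and B: "\<And>t. B t = noise_op M (x t) (J t) (\<Sigma>cov t)"
    and "snr_rate \<in> borel_measurable (lebesgue_on {0..T})"
    and "\<And>t. t \<in> {0..T} \<Longrightarrow> snr_rate t \<ge> 0"
    and "\<And>t D. t \<in> {0..T} \<Longrightarrow> \<sigma> t \<noteq> 0 \<Longrightarrow>
           (\<sigma> has_real_derivative D) (at t within {0..T}) \<Longrightarrow> snr_rate t = D / \<sigma> t ^ 3"
    and "integrable (lebesgue_on {0..T}) (\<lambda>\<tau>. snr_rate \<tau> *\<^sub>R A \<tau>)"
    and Abar: "Abar = (LINT \<tau>|lebesgue_on {0..T}. snr_rate \<tau> *\<^sub>R A \<tau>)"
    and "continuous_on {0..T} A" and "continuous_on {0..T} B"
    and "\<And>t. t \<in> {0..T} \<Longrightarrow> pos_definite (A t)"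
  shows "\<exists>(r::nat) (ts :: nat \<Rightarrow> real) (w :: nat \<Rightarrow> real).
           r \<le> CARD('p) * (CARD('p) + 1) + 1 \<and>
           (\<forall>i\<in>{1..r}. ts i \<in> {0..T} \<and> w i \<ge> 0) \<and>
           (\<Sum>i\<in>{1..r}. w i) = 1 \<and>
           is_arg_min (objective Abar A B) (\<lambda>\<mu>. \<mu> \<in> space (prob_algebra (time_space T)))
             (dirac_mixture (time_space T) {1..r} w ts)"
proof -
  \<comment> \<open>The objective factors as \<open>\<phi>\<close> applied to the mean of the curve
    \<open>f\<close>.\<close>
  define f where "f = (\<lambda>t. (A t, B t))"
  define \<phi> where "\<phi> = (\<lambda>(H, G). trace (Abar ** matrix_inv H ** G ** matrix_inv H))"
  have cont: "continuous_on {0..T} A" "continuous_on {0..T} B"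
    and pos: "\<And>t. t \<in> {0..T} \<Longrightarrow> pos_definite (A t)" by fact+
  have f: "continuous_on {0..T} f"
    unfolding f_def by (intro continuous_intros cont)
  \<comment> \<open>Positive definiteness passes from the curve to its hull by convexity, so
    \<open>\<phi>\<close> inverts only invertible matrices there and is continuous.\<close>
  have hull: "convex hull (f ` {0..T}) \<subseteq> {P. pos_definite P} \<times> UNIV"
    using pos by (intro hull_minimal convex_Times convex_pos_definite convex_UNIV) (auto simp: f_def)
  have inv: "invertible (fst P)" if "P \<in> convex hull (f ` {0..T})" for P
    using subsetD[OF hull that] by (auto intro: pos_definite_invertible)
  have "continuous_on (convex hull (f ` {0..T}))
      (\<lambda>P. trace (Abar ** matrix_inv (fst P) ** snd P ** matrix_inv (fst P)))"
    unfolding trace_def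
    by (intro continuous_intros continuous_on_matrix_mult continuous_on_matrix_inv inv)
  then have \<phi>: "continuous_on (convex hull (f ` {0..T})) \<phi>"
    by (simp add: \<phi>_def case_prod_unfold)
  let ?S = "{(P :: real^'p^'p, Q :: real^'p^'p). transpose P = P \<and> transpose Q = Q}"
  have "transpose (B t) = B t" if "t \<in> {0..T}" for t
    unfolding B by (rule noise_op_symmetric) (rule assms that)+
  then have "f ` {0..T} \<subseteq> ?S"
    using pos by (auto simp: f_def pos_definite_def)
  \<comment> \<open>A subspace has equal affine and linear dimension, so the count of symmetric
    pairs bounds the affine dimension of the curve.\<close>
  then have "aff_dim (f ` {0..T}) \<le> aff_dim ?S"
    by (rule aff_dim_subset)
  also have "\<dots> = int (dim ?S)"
    by (intro aff_dim_subspace subspace_symmetric_pairs)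
  also have "\<dots> \<le> int (CARD('p) * (CARD('p) + 1))"
    using dim_symmetric_pairs_le[where 'n = 'p] by (intro of_nat_mono)
  finally have dim: "aff_dim (f ` {0..T}) \<le> int (CARD('p) * (CARD('p) + 1))" .
  have "{0..T} \<noteq> {}" using \<open>T > 0\<close> by simp
  from atomic_minimizer[OF compact_Icc this f \<phi>]
  obtain r ts w where r: "int r \<le> aff_dim (f ` {0..T}) + 1"
    and tw: "\<And>i. i \<in> {1..r} \<Longrightarrow> ts i \<in> {0..T}" "\<And>i. i \<in> {1..r} \<Longrightarrow> 0 \<le> w i" "sum w {1..r} = 1"
    and min: "is_arg_min (\<lambda>\<mu>. \<phi> (integral\<^sup>L \<mu> f)) (\<lambda>\<mu>. \<mu> \<in> space (prob_algebra (time_space T)))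
      (dirac_mixture (time_space T) {1..r} w ts)"
    by blast
  \<comment> \<open>Integrability of \<open>f\<close> allows the mean of the pair to be taken
    componentwise. Agreement on feasible measures is enough, since \<open>is_arg_min\<close>
    compares only these.\<close>
  have "\<phi> (integral\<^sup>L \<mu> f) = objective Abar A B \<mu>" if "\<mu> \<in> space (prob_algebra (time_space T))" for \<mu>
  proof -
    have "integrable \<mu> f"
      using that by (intro integrable_continuous_compact_space[OF _ _ f]) (auto simp: space_prob_algebra)
    from integral_fst[OF this] integral_snd[OF this] show ?thesis
      by (simp add: f_def \<phi>_def objective_def mean_op_def case_prod_unfold)
  qed
  with min have "is_arg_min (objective Abar A B) (\<lambda>\<mu>. \<mu> \<in> space (prob_algebra (time_space T)))
      (dirac_mixture (time_space T) {1..r} w ts)"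
    by (auto simp: is_arg_min_def)
  moreover have "r \<le> CARD('p) * (CARD('p) + 1) + 1"
    using r dim by linarith
  ultimately show ?thesis
    using tw by blast
qed

end
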